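(* Let $p=(p_{123},p_{132},p_{213},p_{231},p_{312},p_{321})\in\mathbb{R}^6$ be a vector of pattern frequencies of length 3, i.e. a probability vector (nonnegative entries with sum $1$) satisfying $p_{213}+p_{312}-p_{231}-p_{132}=0$. Write $\tau=\tau(p),\ \beta=\beta(p),\ \gamma=\gamma(p),\ \delta=\delta(p)$ for its four pattern contrasts. Then: (a) With $\Delta^2=\sum_{\pi\in S_3}\left(p_\pi-\frac16\right)^2$ one has $$4\Delta^2=3\tau^2+2\beta^2+\gamma^2+\delta^2 .$$ (b) With $p^{BM}=\left(\frac14,\frac18,\frac18,\frac18,\frac18,\frac14\right)$ (the pattern frequencies of symmetric random walk) one has $$4\,|p-p^{BM}|^2=3\left(\tau-\tfrac16\right)^2+2\beta^2+\gamma^2+\delta^2 .$$ (c) For an arbitrary fixed pattern frequency distribution $p^o$ (again a probability vector in $\mathbb{R}^6$ with $p^o_{213}+p^o_{312}-p^o_{231}-p^o_{132}=0$) one has $$4\,|p-p^o|^2=3(\tau(p)-\tau(p^o))^2+2(\beta(p)-\beta(p^o))^2+(\gamma(p)-\gamma(p^o))^2+(\delta(p)-\delta(p^o))^2 .$$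
   Context: Coordinates of $\mathbb{R}^6$ are indexed by the permutations of length 3 in the order $123,132,213,231,312,321$, and $|\cdot|$ is the Euclidean norm. $S_3$ is the set of all permutations of length 3. The four pattern contrasts of a vector $p$ of pattern frequencies are $$\beta(p)=p_{123}-p_{321},\qquad \tau(p)=p_{123}+p_{321}-\tfrac13,$$ $$\gamma(p)=p_{213}+p_{231}-p_{132}-p_{312},\qquad \delta(p)=p_{132}+p_{213}-p_{231}-p_{312}.$$ *)

theory Defs
  imports "HOL-Analysis.Analysis" "HOL-Combinatorics.Multiset_Permutations"
begin

(* Permutations of length 3 in one-line notation. *)
typedef perm3 = "permutations_of_set {1, 2, 3 :: nat}"
  by (rule exI[of _ "[1, 2, 3]"]) (auto simp: permutations_of_set_def)

instance perm3 :: finite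
proof
  have "finite (Abs_perm3 ` permutations_of_set {1, 2, 3 :: nat})"
    by simp
  then show "finite (UNIV :: perm3 set)"
    by (simp only: type_definition.Abs_image[OF type_definition_perm3])
qed

(* Only meaningful when [a, b, c] is a permutation of 1, 2, 3. *)
definition perm :: "nat \<Rightarrow> nat \<Rightarrow> nat \<Rightarrow> perm3" where
  "perm a b c = Abs_perm3 [a, b, c]"

lemma Rep_perm:
  "distinct [a, b, c] \<Longrightarrow> {a, b, c} = {1, 2, 3} \<Longrightarrow> Rep_perm3 (perm a b c) = [a, b, c]"
  by (simp add: perm_def Abs_perm3_inverse permutations_of_set_def)

lemma UNIV_perm3:
  "UNIV = {perm 1 2 3, perm 1 3 2, perm 2 1 3, perm 2 3 1, perm 3 1 2, perm 3 2 1}"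
proof -
  have "\<pi> \<in> {perm 1 2 3, perm 1 3 2, perm 2 1 3, perm 2 3 1, perm 3 1 2, perm 3 2 1}" for \<pi>
  proof -
    have rep: "set (Rep_perm3 \<pi>) = {1, 2, 3}" "distinct (Rep_perm3 \<pi>)"
      using Rep_perm3[of \<pi>] by (simp_all add: permutations_of_set_def)
    have "length (Rep_perm3 \<pi>) = 3"
      using distinct_card[OF rep(2)] rep(1) by simp
    then obtain a b c where abc: "Rep_perm3 \<pi> = [a, b, c]"
      by (auto simp: numeral_3_eq_3 length_Suc_conv)
    then have "\<pi> = perm a b c"
      by (metis Rep_perm3_inverse perm_def)
    moreover have "a \<in> {1, 2, 3}" "b \<in> {1, 2, 3}" "c \<in> {1, 2, 3}" "a \<noteq> b" "a \<noteq> c" "b \<noteq> c"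
      using rep abc by auto
    ultimately show ?thesis
      by fastforce
  qed
  then show ?thesis
    by blast
qed

lemma distinct_perm3:
  "distinct [perm 1 2 3, perm 1 3 2, perm 2 1 3, perm 2 3 1, perm 3 1 2, perm 3 2 1]"
proof -
  have "Rep_perm3 (perm 1 2 3) = [1, 2, 3]" "Rep_perm3 (perm 1 3 2) = [1, 3, 2]"
    "Rep_perm3 (perm 2 1 3) = [2, 1, 3]" "Rep_perm3 (perm 2 3 1) = [2, 3, 1]"
    "Rep_perm3 (perm 3 1 2) = [3, 1, 2]" "Rep_perm3 (perm 3 2 1) = [3, 2, 1]"
    by (rule Rep_perm; (blast | simp))+
  then have "distinct (map Rep_perm3
      [perm 1 2 3, perm 1 3 2, perm 2 1 3, perm 2 3 1, perm 3 1 2, perm 3 2 1])"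
    by simp
  then show ?thesis
    unfolding distinct_map by blast
qed

(* Entries in the coordinate order 123, 132, 213, 231, 312, 321. *)
definition vec6 :: "real \<Rightarrow> real \<Rightarrow> real \<Rightarrow> real \<Rightarrow> real \<Rightarrow> real \<Rightarrow> real ^ perm3" where
  "vec6 x123 x132 x213 x231 x312 x321 =
    (\<chi> \<pi>. if \<pi> = perm 1 2 3 then x123
         else if \<pi> = perm 1 3 2 then x132
         else if \<pi> = perm 2 1 3 then x213
         else if \<pi> = perm 2 3 1 then x231
         else if \<pi> = perm 3 1 2 then x312
         else x321)"

definition pattern_frequencies :: "real ^ perm3 \<Rightarrow> bool" where
  "pattern_frequencies p \<longleftrightarrow>
     (\<forall>\<pi>. 0 \<le> p $ \<pi>) \<and> (\<Sum>\<pi>\<in>UNIV. p $ \<pi>) = 1 \<and>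
     p $ perm 2 1 3 + p $ perm 3 1 2 - p $ perm 2 3 1 - p $ perm 1 3 2 = 0"

definition \<beta> :: "real ^ perm3 \<Rightarrow> real" where
  "\<beta> p = p $ perm 1 2 3 - p $ perm 3 2 1"

definition \<tau> :: "real ^ perm3 \<Rightarrow> real" where
  "\<tau> p = p $ perm 1 2 3 + p $ perm 3 2 1 - 1/3"

definition \<gamma> :: "real ^ perm3 \<Rightarrow> real" where
  "\<gamma> p = p $ perm 2 1 3 + p $ perm 2 3 1 - p $ perm 1 3 2 - p $ perm 3 1 2"

definition \<delta> :: "real ^ perm3 \<Rightarrow> real" where
  "\<delta> p = p $ perm 1 3 2 + p $ perm 2 1 3 - p $ perm 2 3 1 - p $ perm 3 1 2"

definition p_BM :: "real ^ perm3" where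
  "p_BM = vec6 (1/4) (1/8) (1/8) (1/8) (1/8) (1/4)"

end

theory Submission
  imports Defs
begin

text \<open>
  All three parts are one Pythagorean identity. Applied to the difference \<open>d\<close> of two pattern frequency
  vectors, the functionals \<open>d\<^sub>1\<^sub>2\<^sub>3 \<plusminus> d\<^sub>3\<^sub>2\<^sub>1\<close> are orthogonal coordinates on the two monotone patterns,
  and the four sign sums of a \<open>4 \<times> 4\<close> Hadamard matrix are orthogonal coordinates on the other four.
  Two of these sign sums are the contrasts \<open>\<gamma>\<close> and \<open>\<delta>\<close>. A third vanishes by the linear relation
  \<open>p\<^sub>2\<^sub>1\<^sub>3 + p\<^sub>3\<^sub>1\<^sub>2 = p\<^sub>2\<^sub>3\<^sub>1 + p\<^sub>1\<^sub>3\<^sub>2\<close>. The fourth, the plain sum, equals \<open>-(d\<^sub>1\<^sub>2\<^sub>3 + d\<^sub>3\<^sub>2\<^sub>1)\<close> because the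
  entries of \<open>d\<close> add up to \<open>0\<close>; it raises the weight of the \<open>\<tau>\<close>-term from 2 to 3.
  This gives the formula for an arbitrary reference distribution (\<open>norm_diff_contrasts\<close>).
  The other two parts take as reference the uniform distribution, where all contrasts vanish, and
  \<open>p_BM\<close>, where \<open>\<tau> = 1/6\<close> and the other contrasts vanish.
\<close>

lemma sum_perm3:
  fixes f :: "perm3 \<Rightarrow> 'a :: comm_monoid_add"
  shows "(\<Sum>\<pi>\<in>UNIV. f \<pi>) = f (perm 1 2 3) + f (perm 1 3 2) + f (perm 2 1 3)
    + f (perm 2 3 1) + f (perm 3 1 2) + f (perm 3 2 1)"
  unfolding UNIV_perm3 using distinct_perm3 by (simp add: add.assoc)

lemma power2_norm_perm3:
  fixes x :: "real ^ perm3"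
  shows "(norm x)^2 = (\<Sum>\<pi>\<in>UNIV. (x $ \<pi>)^2)"
  by (simp add: power2_norm_eq_inner inner_vec_def flip: power2_eq_square)

text \<open>
  The rows of a Hadamard matrix are orthogonal, each of squared norm \<open>4\<close>, so the squares of the four
  sign sums of a vector add up to four times its squared length.
\<close>

lemma hadamard4_sum_squares:
  fixes a b c e :: "'a :: comm_ring_1"
  shows "4 * (a^2 + b^2 + c^2 + e^2) =
    (a + b + c + e)^2 + (b + e - c - a)^2 + (b + c - a - e)^2 + (a + b - c - e)^2"
  by (simp add: power2_eq_square algebra_simps)

theorem norm_diff_contrasts:
  assumes p: "pattern_frequencies p" and q: "pattern_frequencies q"
  shows "4 * (norm (p - q))^2 =
    3 * (\<tau> p - \<tau> q)^2 + 2 * (\<beta> p - \<beta> q)^2 + (\<gamma> p - \<gamma> q)^2 + (\<delta> p - \<delta> q)^2"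
proof -
  define x where "x = p $ perm 1 2 3 - q $ perm 1 2 3"
  define a where "a = p $ perm 1 3 2 - q $ perm 1 3 2"
  define b where "b = p $ perm 2 1 3 - q $ perm 2 1 3"
  define c where "c = p $ perm 2 3 1 - q $ perm 2 3 1"
  define e where "e = p $ perm 3 1 2 - q $ perm 3 1 2"
  define y where "y = p $ perm 3 2 1 - q $ perm 3 2 1"
  note defs = x_def a_def b_def c_def e_def y_def
  have plain_sum: "a + b + c + e = - (x + y)"
    using p q unfolding pattern_frequencies_def sum_perm3 defs by linarith
  have balanced: "b + e - c - a = 0"
    using p q unfolding pattern_frequencies_def defs by linarith
  have contrasts: "\<tau> p - \<tau> q = x + y" "\<beta> p - \<beta> q = x - y"
    "\<gamma> p - \<gamma> q = b + c - a - e" "\<delta> p - \<delta> q = a + b - c - e"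
    by (simp_all add: \<tau>_def \<beta>_def \<gamma>_def \<delta>_def defs)
  have "4 * (norm (p - q))^2 = 4 * (x^2 + y^2) + 4 * (a^2 + b^2 + c^2 + e^2)"
    by (simp add: power2_norm_perm3 sum_perm3 defs)
  also have "4 * (x^2 + y^2) = 2 * (x + y)^2 + 2 * (x - y)^2"
    by (simp add: power2_eq_square algebra_simps)
  also have "4 * (a^2 + b^2 + c^2 + e^2) = (x + y)^2 + (b + c - a - e)^2 + (a + b - c - e)^2"
    unfolding hadamard4_sum_squares plain_sum balanced by (simp only: power2_minus) simp
  finally show ?thesis
    unfolding contrasts by simp
qed

lemma vec6_nth:
  "vec6 x1 x2 x3 x4 x5 x6 $ perm 1 2 3 = x1" "vec6 x1 x2 x3 x4 x5 x6 $ perm 1 3 2 = x2"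
  "vec6 x1 x2 x3 x4 x5 x6 $ perm 2 1 3 = x3" "vec6 x1 x2 x3 x4 x5 x6 $ perm 2 3 1 = x4"
  "vec6 x1 x2 x3 x4 x5 x6 $ perm 3 1 2 = x5" "vec6 x1 x2 x3 x4 x5 x6 $ perm 3 2 1 = x6"
  using distinct_perm3 by (auto simp: vec6_def)

lemma pattern_frequencies_p_BM: "pattern_frequencies p_BM"
proof -
  have "0 \<le> p_BM $ \<pi>" for \<pi>
    by (simp add: p_BM_def vec6_def)
  then show ?thesis
    unfolding pattern_frequencies_def sum_perm3 p_BM_def vec6_nth by simp
qed

lemma contrasts_p_BM: "\<tau> p_BM = 1/6" "\<beta> p_BM = 0" "\<gamma> p_BM = 0" "\<delta> p_BM = 0"
  unfolding \<tau>_def \<beta>_def \<gamma>_def \<delta>_def p_BM_def vec6_nth by simp_all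

lemma pattern_frequencies_uniform: "pattern_frequencies (\<chi> \<pi>. 1/6)"
  unfolding pattern_frequencies_def sum_perm3 by simp

lemma contrasts_uniform:
  "\<tau> (\<chi> \<pi>. 1/6) = 0" "\<beta> (\<chi> \<pi>. 1/6) = 0" "\<gamma> (\<chi> \<pi>. 1/6) = 0" "\<delta> (\<chi> \<pi>. 1/6) = 0"
  by (simp_all add: \<tau>_def \<beta>_def \<gamma>_def \<delta>_def)

theorem proposition1:
  fixes p :: "real ^ perm3"
  assumes "pattern_frequencies p"
  shows "4 * (\<Sum>\<pi>\<in>UNIV. (p $ \<pi> - 1/6)^2) = 3 * (\<tau> p)^2 + 2 * (\<beta> p)^2 + (\<gamma> p)^2 + (\<delta> p)^2
    \<and> 4 * (norm (p - p_BM))^2 = 3 * (\<tau> p - 1/6)^2 + 2 * (\<beta> p)^2 + (\<gamma> p)^2 + (\<delta> p)^2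
    \<and> (\<forall>po :: real ^ perm3. pattern_frequencies po \<longrightarrow>
         4 * (norm (p - po))^2 =
           3 * (\<tau> p - \<tau> po)^2 + 2 * (\<beta> p - \<beta> po)^2 + (\<gamma> p - \<gamma> po)^2 + (\<delta> p - \<delta> po)^2)"
proof (intro conjI allI impI)
  have "(\<Sum>\<pi>\<in>UNIV. (p $ \<pi> - 1/6)^2) = (norm (p - (\<chi> \<pi>. 1/6)))^2"
    by (simp add: power2_norm_perm3)
  then show "4 * (\<Sum>\<pi>\<in>UNIV. (p $ \<pi> - 1/6)^2) = 3 * (\<tau> p)^2 + 2 * (\<beta> p)^2 + (\<gamma> p)^2 + (\<delta> p)^2"
    using norm_diff_contrasts[OF assms pattern_frequencies_uniform]
    unfolding contrasts_uniform by simp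
  show "4 * (norm (p - p_BM))^2 = 3 * (\<tau> p - 1/6)^2 + 2 * (\<beta> p)^2 + (\<gamma> p)^2 + (\<delta> p)^2"
    using norm_diff_contrasts[OF assms pattern_frequencies_p_BM]
    unfolding contrasts_p_BM by simp
  show "4 * (norm (p - po))^2 =
      3 * (\<tau> p - \<tau> po)^2 + 2 * (\<beta> p - \<beta> po)^2 + (\<gamma> p - \<gamma> po)^2 + (\<delta> p - \<delta> po)^2"
    if "pattern_frequencies po" for po
    by (rule norm_diff_contrasts[OF assms that])
qed

end
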